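(* Let $(G,D)$ be a connected $3$-transposition group, $M=M_\eta(G,D)$, let $\sigma$ be a flip of $M$ and $W=[M,\sigma]=\{u-u^\sigma\mid u\in M\}$. Let $\Lambda$ be the set of eigenvalues of the collinearity map $t$ on $M$ and, for $\lambda\in\Lambda$, let $m_\lambda$ (possibly zero) be the multiplicity of $\lambda$ as an eigenvalue of $t$ on $W$, i.e. the dimension of the $\lambda$-eigenspace of $t$ in $W$. Then $$\sum_{\lambda\in\Lambda}m_\lambda=\dim W.$$
   Context: $\mathbb F$ is a field of characteristic $0$ and $\eta\in\mathbb F\setminus\{0,1\}$. A $3$-transposition group $(G,D)$ is a finite group $G$ with a normal generating subset $D$ of elements of order $2$ such that $|de|\le 3$ for all $d,e\in D$; it is connected if $D$ is a single conjugacy class. As a vector space, the Matsuo algebra $M=M_\eta(G,D)$ is the $\mathbb F$-space with basis $D$ (the algebra product is not needed here). A flip $\sigma$ of $M$ is an automorphism of order $2$ of the group $G$ with $D^\sigma=D$, acting linearly on $M$ by permuting the basis $D$. The collinearity map is the linear map $t:M\to M$ with $t(d)=\sum_{c\in D,\,|cd|=3}c$ for $d\in D$. It commutes with $\sigma$, so it leaves $W$ invariant. It is a known fact (from the tables of spectra of $3$-transposition groups by Hall and Shpectorov) that all eigenvalues of $t$ are integers, so in particular they lie in $\mathbb F$. *)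

theory Defs
  imports "HOL-Algebra.Algebra" "HOL-Library.Function_Algebras" "HOL.Vector_Spaces"
begin

locale three_transposition_group = group G for G (structure) +
  fixes D
  assumes finite_carrier: "finite (carrier G)"
    and D_subset: "D \<subseteq> carrier G"
    and D_normal: "\<lbrakk>g \<in> carrier G; d \<in> D\<rbrakk> \<Longrightarrow> g \<otimes> d \<otimes> inv g \<in> D"
    and D_generates: "generate G D = carrier G"
    and D_involution: "d \<in> D \<Longrightarrow> ord d = 2"
    and D_ord_le_3: "\<lbrakk>d \<in> D; e \<in> D\<rbrakk> \<Longrightarrow> ord (d \<otimes> e) \<le> 3"

locale connected_three_transposition_group = three_transposition_group +
  assumes D_conjugacy_class: "\<exists>d\<in>carrier G. D = {g \<otimes> d \<otimes> inv g | g. g \<in> carrier G}"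

text \<open>
  The vector space with basis \<open>D\<close> is realised inside the space of all functions
  \<open>'a \<Rightarrow> 'f\<close> with pointwise operations: \<open>u\<close> is the coefficient vector of
  \<open>\<Sum>d\<in>D. u d \<cdot> d\<close>, so that the basis element \<open>d\<close> is \<open>basis_vec d\<close>.
\<close>

definition fun_scale :: "'f::field \<Rightarrow> ('a \<Rightarrow> 'f) \<Rightarrow> 'a \<Rightarrow> 'f" where
  "fun_scale a u = (\<lambda>x. a * u x)"

interpretation fun_vs: vector_space fun_scale
  by unfold_locales (auto simp: fun_scale_def algebra_simps)

definition basis_vec :: "'a \<Rightarrow> 'a \<Rightarrow> 'f::field" where
  "basis_vec d = (\<lambda>x. if x = d then 1 else 0)"

text \<open>The underlying vector space of the Matsuo algebra, which does not depend on \<open>\<eta>\<close>.\<close>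

definition matsuo_space :: "'a set \<Rightarrow> ('a \<Rightarrow> 'f::field) set" where
  "matsuo_space D = {u. \<forall>x. x \<notin> D \<longrightarrow> u x = 0}"

text \<open>
  Maps on the space are given by linear extension from \<open>D\<close>; they are only meaningful
  on \<open>matsuo_space D\<close>.
\<close>

definition lin_ext :: "'a set \<Rightarrow> ('a \<Rightarrow> 'a \<Rightarrow> 'f::field) \<Rightarrow> ('a \<Rightarrow> 'f) \<Rightarrow> 'a \<Rightarrow> 'f" where
  "lin_ext D f u = (\<Sum>d\<in>D. fun_scale (u d) (f d))"

definition collinearity_map ::
    "('a, 'b) monoid_scheme \<Rightarrow> 'a set \<Rightarrow> ('a \<Rightarrow> 'f::field) \<Rightarrow> 'a \<Rightarrow> 'f" where
  "collinearity_map G D =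
     lin_ext D (\<lambda>d. \<Sum>c\<in>{c \<in> D. group.ord G (c \<otimes>\<^bsub>G\<^esub> d) = 3}. basis_vec c)"

text \<open>
  \<open>auto G\<close> consists of extensional functions, so the order of \<open>\<sigma>\<close> in \<open>AutoGroup G\<close>
  only concerns its values on \<open>carrier G\<close>.
\<close>

definition is_flip :: "('a, 'b) monoid_scheme \<Rightarrow> 'a set \<Rightarrow> ('a \<Rightarrow> 'a) \<Rightarrow> bool" where
  "is_flip G D \<sigma> \<longleftrightarrow> \<sigma> \<in> auto G \<and> group.ord (AutoGroup G) \<sigma> = 2 \<and> \<sigma> ` D = D"

definition flip_act :: "'a set \<Rightarrow> ('a \<Rightarrow> 'a) \<Rightarrow> ('a \<Rightarrow> 'f::field) \<Rightarrow> 'a \<Rightarrow> 'f" where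
  "flip_act D \<sigma> = lin_ext D (\<lambda>d. basis_vec (\<sigma> d))"

definition flip_commutator :: "'a set \<Rightarrow> ('a \<Rightarrow> 'a) \<Rightarrow> ('a \<Rightarrow> 'f::field) set" where
  "flip_commutator D \<sigma> = {u - flip_act D \<sigma> u | u. u \<in> matsuo_space D}"

definition eigenspace_on ::
    "('a \<Rightarrow> 'f::field) set \<Rightarrow> (('a \<Rightarrow> 'f) \<Rightarrow> 'a \<Rightarrow> 'f) \<Rightarrow> 'f \<Rightarrow> ('a \<Rightarrow> 'f) set" where
  "eigenspace_on V f l = {u \<in> V. f u = fun_scale l u}"

definition eigenvalues_on ::
    "('a \<Rightarrow> 'f::field) set \<Rightarrow> (('a \<Rightarrow> 'f) \<Rightarrow> 'a \<Rightarrow> 'f) \<Rightarrow> 'f set" where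
  "eigenvalues_on V f = {l. \<exists>u\<in>eigenspace_on V f l. u \<noteq> 0}"

end

theory Submission
  imports Defs "HOL-Computational_Algebra.Fundamental_Theorem_Algebra"
begin

text \<open>
  If \<open>d\<close> and \<open>c\<close> do not commute, then \<open>d\<^sup>c = c\<^sup>d\<close>, and \<open>c \<mapsto> c\<^sup>d\<close> permutes the elements
  of \<open>D\<close> not commuting with \<open>d\<close>. Hence the class sum of \<open>D\<close>, acting on \<open>M\<close> by conjugation,
  equals \<open>k + t\<close>, where \<open>k\<close> is the number of elements of \<open>D\<close> commuting with a given one; by
  connectedness it is independent of the choice. Over the complex numbers \<open>t\<close> is given by a real
  symmetric matrix, so it is diagonalisable, and each spectral projection \<open>P\<close> commutes with the
  conjugation by each \<open>c \<in> D\<close>. Taking traces of (class sum) \<open>\<cdot> P\<close> shows that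
  \<open>(k + \<lambda>) dim (P M)\<close> is a sum of traces of involutions, hence an integer, and so \<open>\<lambda>\<close> is rational.
  A product of distinct factors \<open>t - r\<close> with \<open>r\<close> rational therefore vanishes, and this identity
  descends to the rationals and ascends to every field of characteristic 0. It passes to the
  \<open>t\<close>-invariant subspace \<open>W\<close>, which is thus the direct sum of its eigenspaces.
\<close>

subsection \<open>Linear maps and eigenspaces\<close>

abbreviation fun_linear :: "(('a \<Rightarrow> 'f::field) \<Rightarrow> 'a \<Rightarrow> 'f) \<Rightarrow> bool" where
  "fun_linear \<equiv> module_hom fun_scale fun_scale"

lemmas fun_linear_add = module_hom.add[where ?s1.0 = fun_scale and ?s2.0 = fun_scale]
  and fun_linear_scale = module_hom.scale[where ?s1.0 = fun_scale and ?s2.0 = fun_scale]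
  and fun_linear_diff = module_hom.diff[where ?s1.0 = fun_scale and ?s2.0 = fun_scale]
  and fun_linear_sum = module_hom.sum[where ?s1.0 = fun_scale and ?s2.0 = fun_scale]
  and fun_linear_zero = module_hom.zero[where ?s1.0 = fun_scale and ?s2.0 = fun_scale]

lemma fun_linearI:
  assumes "\<And>u v. T (u + v) = T u + T v" and "\<And>a u. T (fun_scale a u) = fun_scale a (T u)"
  shows "fun_linear T"
  using assms by unfold_locales (auto simp: fun_vs.scale_right_distrib fun_vs.scale_left_distrib)

lemma sum_apply: "(\<Sum>x\<in>A. f x) y = (\<Sum>x\<in>A. f x y :: 'b::comm_monoid_add)"
  by (induction A rule: infinite_finite_induct) simp_all

lemma subspace_matsuo_space: "fun_vs.subspace (matsuo_space D)"
  by (auto simp: fun_vs.subspace_def matsuo_space_def fun_scale_def)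

lemma matsuo_space_expand:
  assumes "finite D" and "u \<in> matsuo_space D"
  shows "u = (\<Sum>x\<in>D. fun_scale (u x) (basis_vec x))"
proof
  fix y
  have "(\<Sum>x\<in>D. fun_scale (u x) (basis_vec x)) y = (\<Sum>x\<in>D. if y = x then u x else 0)"
    by (simp add: sum_apply fun_scale_def basis_vec_def if_distrib cong: if_cong)
  also have "\<dots> = u y"
    using assms by (simp add: matsuo_space_def)
  finally show "u y = (\<Sum>x\<in>D. fun_scale (u x) (basis_vec x)) y" ..
qed

lemma basis_vec_in_matsuo_space: "x \<in> D \<Longrightarrow> basis_vec x \<in> matsuo_space D"
  by (auto simp: matsuo_space_def basis_vec_def)

lemma matsuo_space_subset_span:
  assumes "finite D"
  shows "matsuo_space D \<subseteq> fun_vs.span (basis_vec ` D)"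
proof
  fix u :: "'a \<Rightarrow> 'f::field"
  assume "u \<in> matsuo_space D"
  then have "u = (\<Sum>x\<in>D. fun_scale (u x) (basis_vec x))"
    using assms by (rule matsuo_space_expand[rotated])
  also have "\<dots> \<in> fun_vs.span (basis_vec ` D)"
    by (intro fun_vs.span_sum fun_vs.span_scale fun_vs.span_base) auto
  finally show "u \<in> fun_vs.span (basis_vec ` D)" .
qed

lemma finite_independent_matsuo_space:
  fixes B :: "('a \<Rightarrow> 'f::field) set"
  assumes "finite D" and "fun_vs.independent B" and "B \<subseteq> matsuo_space D"
  shows "finite B" and "card B \<le> card D"
proof -
  have "B \<subseteq> fun_vs.span (basis_vec ` D)"
    using assms(3) matsuo_space_subset_span[OF assms(1)] by (rule subset_trans)
  then have *: "finite B \<and> card B \<le> card ((basis_vec :: 'a \<Rightarrow> 'a \<Rightarrow> 'f) ` D)"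
    using assms(1,2) by (intro fun_vs.independent_span_bound) auto
  then show "finite B" ..
  show "card B \<le> card D"
    using * card_image_le[OF assms(1)] by (auto intro: order_trans)
qed

lemma fun_linear_eq_on_basis:
  assumes "finite D" and "fun_linear S" and "fun_linear T"
    and "\<And>x. x \<in> D \<Longrightarrow> S (basis_vec x) = T (basis_vec x)" and "u \<in> matsuo_space D"
  shows "S u = T u"
proof -
  have "S u = S (\<Sum>x\<in>D. fun_scale (u x) (basis_vec x))"
    using matsuo_space_expand[OF assms(1,5)] by simp
  also have "\<dots> = T (\<Sum>x\<in>D. fun_scale (u x) (basis_vec x))"
    using assms(4) by (simp add: fun_linear_sum[OF assms(2)] fun_linear_scale[OF assms(2)]
      fun_linear_sum[OF assms(3)] fun_linear_scale[OF assms(3)])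
  also have "\<dots> = T u"
    using matsuo_space_expand[OF assms(1,5)] by simp
  finally show ?thesis .
qed

section \<open>Traces of idempotents\<close>

definition fun_trace :: "'a set \<Rightarrow> (('a \<Rightarrow> 'f::field) \<Rightarrow> 'a \<Rightarrow> 'f) \<Rightarrow> 'f" where
  "fun_trace D T = (\<Sum>x\<in>D. T (basis_vec x) x)"

text \<open>With \<open>B\<close> a basis of the image, \<open>T\<close> factors through the
  coordinates with respect to \<open>B\<close>. Interchanging the two factors leaves the trace
  unchanged and yields the identity on the image, so the trace is the rank. The clause on
  \<open>n = 0\<close> concerns the rank itself, so that in characteristic 0 a nonzero idempotent
  has nonzero trace.\<close>

lemma fun_trace_idempotent:
  fixes T :: "('a \<Rightarrow> 'f::field) \<Rightarrow> 'a \<Rightarrow> 'f"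
  assumes fin: "finite D" and lin: "fun_linear T"
    and closed: "\<And>u. u \<in> matsuo_space D \<Longrightarrow> T u \<in> matsuo_space D"
    and idem: "\<And>u. u \<in> matsuo_space D \<Longrightarrow> T (T u) = T u"
  obtains n :: nat where "fun_trace D T = of_nat n"
    and "n = 0 \<longrightarrow> (\<forall>u\<in>matsuo_space D. T u = 0)"
proof -
  obtain B where B: "B \<subseteq> T ` matsuo_space D" "fun_vs.independent B"
      "T ` matsuo_space D \<subseteq> fun_vs.span B"
    by (rule fun_vs.basis_exists)
  have BM: "B \<subseteq> matsuo_space D"
    using B closed by auto
  have finB: "finite B"
    using fin B(2) BM by (rule finite_independent_matsuo_space)
  define \<gamma> where "\<gamma> x b = fun_vs.representation B (T (basis_vec x)) b" for x b
  have expand: "T (basis_vec x) x = (\<Sum>b\<in>B. \<gamma> x b * b x)" if "x \<in> D" for x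
  proof -
    have "T (basis_vec x) \<in> fun_vs.span B"
      using B(3) basis_vec_in_matsuo_space[OF that] by auto
    from fun_vs.sum_representation_eq[OF B(2) this finB subset_refl]
    have "T (basis_vec x) = (\<Sum>b\<in>B. fun_scale (\<gamma> x b) b)"
      unfolding \<gamma>_def by simp
    then have "T (basis_vec x) x = (\<Sum>b\<in>B. fun_scale (\<gamma> x b) b) x"
      by simp
    then show ?thesis
      by (simp add: sum_apply fun_scale_def)
  qed
  \<comment> \<open>The left side is the \<open>b\<close>-coordinate of \<open>T b\<close>, computed
    by expanding \<open>b\<close> over \<open>D\<close>; and \<open>T b = b\<close>, because
    \<open>b\<close> lies in the image of an idempotent.\<close>
  have dual: "(\<Sum>x\<in>D. \<gamma> x b * b x) = 1" if b: "b \<in> B" for b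
  proof -
    have inspan: "T (basis_vec x) \<in> fun_vs.span B" if "x \<in> D" for x
      using B(3) basis_vec_in_matsuo_space[OF that] by auto
    have "b = T b"
      using b B(1) idem by auto
    also have "T b = T (\<Sum>x\<in>D. fun_scale (b x) (basis_vec x))"
      using matsuo_space_expand[OF fin, of b] b BM by auto
    also have "\<dots> = (\<Sum>x\<in>D. fun_scale (b x) (T (basis_vec x)))"
      by (simp add: fun_linear_sum[OF lin] fun_linear_scale[OF lin])
    finally have *: "b = (\<Sum>x\<in>D. fun_scale (b x) (T (basis_vec x)))" .
    have "fun_vs.representation B b =
        fun_vs.representation B (\<Sum>x\<in>D. fun_scale (b x) (T (basis_vec x)))"
      using * by (rule arg_cong)
    then have "fun_vs.representation B b b = (\<Sum>x\<in>D. b x * \<gamma> x b)"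
      using B(2) inspan
      by (simp add: fun_vs.representation_sum fun_vs.representation_scale fun_vs.span_scale \<gamma>_def)
    then show ?thesis
      using fun_vs.representation_basis[OF B(2) b] by (simp add: mult.commute)
  qed
  have "fun_trace D T = (\<Sum>x\<in>D. \<Sum>b\<in>B. \<gamma> x b * b x)"
    by (simp add: fun_trace_def expand)
  also have "\<dots> = (\<Sum>b\<in>B. \<Sum>x\<in>D. \<gamma> x b * b x)"
    by (rule sum.swap)
  also have "\<dots> = of_nat (card B)"
    by (simp add: dual)
  finally show thesis
  proof (rule that)
    show "card B = 0 \<longrightarrow> (\<forall>u\<in>matsuo_space D. T u = 0)"
      using finB B(3) by auto
  qed
qed

section \<open>Split polynomials in a linear map, encoded by the list of their roots\<close>

definition shift_prod :: "(('a \<Rightarrow> 'f::field) \<Rightarrow> 'a \<Rightarrow> 'f) \<Rightarrow> 'f list \<Rightarrow> ('a \<Rightarrow> 'f) \<Rightarrow> 'a \<Rightarrow> 'f" where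
  "shift_prod T ls u = foldr (\<lambda>l v. T v - fun_scale l v) ls u"

lemma shift_prod_simps [simp]:
  "shift_prod T [] u = u"
  "shift_prod T (l # ls) u = T (shift_prod T ls u) - fun_scale l (shift_prod T ls u)"
  by (simp_all add: shift_prod_def)

lemma shift_prod_append: "shift_prod T (ks @ ls) u = shift_prod T ks (shift_prod T ls u)"
  by (simp add: shift_prod_def)

lemma fun_linear_shift_prod:
  assumes "fun_linear T"
  shows "fun_linear (shift_prod T ls)"
proof (induction ls)
  case (Cons l ls)
  note lin = fun_linear_add[OF Cons] fun_linear_add[OF assms]
    fun_linear_scale[OF Cons] fun_linear_scale[OF assms]
  show ?case
    by (rule fun_linearI)
      (simp_all only: shift_prod_simps lin fun_vs.scale_right_distrib add_diff_add
        fun_vs.scale_right_diff_distrib fun_vs.scale_scale mult.commute)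
qed (auto intro!: fun_linearI)

text \<open>Membership in \<open>U\<close> is part of the conclusion because commutation is assumed
  on \<open>U\<close> only, so the induction must know that every intermediate vector stays
  there.\<close>

lemma shift_prod_commute:
  assumes "fun_linear S" and "\<And>u. u \<in> U \<Longrightarrow> S (T u) = T (S u)"
    and "fun_vs.subspace U" and "\<And>u. u \<in> U \<Longrightarrow> T u \<in> U" and "u \<in> U"
  shows "shift_prod T ls u \<in> U \<and> S (shift_prod T ls u) = shift_prod T ls (S u)"
  using assms(2-)
  by (induction ls)
    (auto simp: fun_linear_diff[OF assms(1)] fun_linear_scale[OF assms(1)]
      intro!: fun_vs.subspace_diff fun_vs.subspace_scale)

lemma shift_prod_closed:
  assumes "fun_vs.subspace U" and "\<And>u. u \<in> U \<Longrightarrow> T u \<in> U" and "u \<in> U"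
  shows "shift_prod T ls u \<in> U"
  using assms by (induction ls) (auto intro!: fun_vs.subspace_diff fun_vs.subspace_scale)

lemma shift_prod_self_commute:
  assumes "fun_linear T"
  shows "shift_prod T ls (T u) = T (shift_prod T ls u)"
  using shift_prod_commute[OF assms, where U = UNIV] by simp

lemma shift_prod_Cons_right:
  assumes "fun_linear T"
  shows "shift_prod T (l # ls) u = shift_prod T ls (T u - fun_scale l u)"
  by (simp add: shift_prod_self_commute[OF assms] fun_linear_diff[OF fun_linear_shift_prod[OF assms]]
    fun_linear_scale[OF fun_linear_shift_prod[OF assms]])

text \<open>All factors are polynomials in the same map and hence commute. The induction moves the
  head \<open>k\<close> past \<open>as\<close> to its place in \<open>ls\<close>.\<close>

lemma shift_prod_perm:
  assumes "fun_linear T" and "mset ks = mset ls"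
  shows "shift_prod T ks u = shift_prod T ls u"
  using assms(2)
proof (induction ks arbitrary: ls)
  case (Cons k ks)
  then obtain as bs where ls: "ls = as @ k # bs"
    by (metis list.set_intros(1) set_mset_mset split_list)
  with Cons have "shift_prod T ks u = shift_prod T (as @ bs) u"
    by simp
  then have "shift_prod T (k # ks) u = shift_prod T (k # as) (shift_prod T bs u)"
    by (simp add: shift_prod_append)
  also have "\<dots> = shift_prod T ls u"
    unfolding shift_prod_Cons_right[OF assms(1)] ls by (simp add: shift_prod_append)
  finally show ?case .
qed simp

lemma shift_prod_eigenvector:
  assumes "fun_linear T" and "T u = fun_scale c u"
  shows "shift_prod T ls u = fun_scale (\<Prod>l\<leftarrow>ls. c - l) u"
  by (induction ls) (auto simp: assms(2) fun_linear_scale[OF assms(1)] fun_vs.scale_left_diff_distrib[symmetric]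
      left_diff_distrib mult.commute)

section \<open>Decomposition into eigenspaces\<close>

lemma subspace_eigenspace_on:
  assumes "fun_linear T" and "fun_vs.subspace U"
  shows "fun_vs.subspace (eigenspace_on U T l)"
  using assms(2)
  by (auto simp: fun_vs.subspace_def eigenspace_on_def
      fun_linear_zero[OF assms(1)] fun_linear_add[OF assms(1)] fun_linear_scale[OF assms(1)]
      fun_vs.scale_right_distrib mult.commute)

text \<open>A basis of \<open>U\<close> and a basis of \<open>V\<close> together form a basis of the
  sum. Lying in \<open>matsuo_space D\<close> makes both bases finite, so their cardinalities add
  up.\<close>

lemma dim_direct_sum:
  assumes "finite D" and U: "fun_vs.subspace U" "U \<subseteq> matsuo_space D"
    and V: "fun_vs.subspace V" "V \<subseteq> matsuo_space D"
    and "U \<inter> V = {0}"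
  shows "fun_vs.dim {u + v | u v. u \<in> U \<and> v \<in> V} = fun_vs.dim U + fun_vs.dim V"
proof -
  obtain B where B: "B \<subseteq> U" "fun_vs.independent B" "U \<subseteq> fun_vs.span B" "card B = fun_vs.dim U"
    by (rule fun_vs.basis_exists)
  obtain C where C: "C \<subseteq> V" "fun_vs.independent C" "V \<subseteq> fun_vs.span C" "card C = fun_vs.dim V"
    by (rule fun_vs.basis_exists)
  have finite: "finite B" "finite C"
    using finite_independent_matsuo_space(1)[OF assms(1) B(2)]
      finite_independent_matsuo_space(1)[OF assms(1) C(2)] B(1) C(1) U(2) V(2) by auto
  have span: "fun_vs.span B = U" "fun_vs.span C = V"
    using fun_vs.span_minimal[OF B(1) U(1)] fun_vs.span_minimal[OF C(1) V(1)] B(3) C(3) by auto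
  \<comment> \<open>A common element of \<open>B\<close> and \<open>C\<close> could only be 0, which
    an independent set does not contain.\<close>
  have "0 \<notin> B"
    using B(2) fun_vs.dependent_zero[of B] by auto
  then have disj: "B \<inter> C = {}"
    using Int_mono[OF B(1) C(1)] assms(6) by auto
  have indep: "fun_vs.independent (B \<union> C)"
  proof (subst fun_vs.independent_explicit_finite_subsets, intro allI impI ballI)
    fix S f v
    assume S: "S \<subseteq> B \<union> C" "finite S" and sum: "(\<Sum>v\<in>S. fun_scale (f v) v) = 0" and v: "v \<in> S"
    have "S \<inter> B \<union> S \<inter> C = S"
      using S by auto
    moreover have "(\<Sum>v\<in>S \<inter> B \<union> S \<inter> C. fun_scale (f v) v) =
        (\<Sum>v\<in>S \<inter> B. fun_scale (f v) v) + (\<Sum>v\<in>S \<inter> C. fun_scale (f v) v)"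
      using S disj by (intro sum.union_disjoint) auto
    ultimately have "(\<Sum>v\<in>S. fun_scale (f v) v) =
        (\<Sum>v\<in>S \<inter> B. fun_scale (f v) v) + (\<Sum>v\<in>S \<inter> C. fun_scale (f v) v)"
      by (simp only:)
    \<comment> \<open>The part of the relation over \<open>B\<close> is in \<open>U\<close> and, by
      this equation, also in \<open>V\<close>, so both parts vanish separately.\<close>
    with sum have eq: "(\<Sum>v\<in>S \<inter> B. fun_scale (f v) v) = - (\<Sum>v\<in>S \<inter> C. fun_scale (f v) v)"
      by (simp only: eq_neg_iff_add_eq_0)
    have inU: "(\<Sum>v\<in>S \<inter> B. fun_scale (f v) v) \<in> U"
      using U B(1) by (intro fun_vs.subspace_sum fun_vs.subspace_scale) auto
    have inV: "(\<Sum>v\<in>S \<inter> C. fun_scale (f v) v) \<in> V"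
      using V C(1) by (intro fun_vs.subspace_sum fun_vs.subspace_scale) auto
    then have "(\<Sum>v\<in>S \<inter> B. fun_scale (f v) v) \<in> V"
      unfolding eq using V(1) by (rule fun_vs.subspace_neg[rotated])
    with inU assms(6) have 0: "(\<Sum>v\<in>S \<inter> B. fun_scale (f v) v) = 0"
      by (metis IntI singletonD)
    with eq have "(\<Sum>v\<in>S \<inter> C. fun_scale (f v) v) = 0"
      by simp
    with 0 v S show "f v = 0"
      using B(2)[unfolded fun_vs.independent_explicit_finite_subsets, rule_format, of "S \<inter> B" f v]
        C(2)[unfolded fun_vs.independent_explicit_finite_subsets, rule_format, of "S \<inter> C" f v]
      by auto
  qed
  have sp: "fun_vs.span (B \<union> C) = {u + v | u v. u \<in> U \<and> v \<in> V}"
    by (simp add: fun_vs.span_Un span)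
  have "fun_vs.dim {u + v | u v. u \<in> U \<and> v \<in> V} = card (B \<union> C)"
    unfolding sp[symmetric] fun_vs.dim_span
    using indep by (rule fun_vs.dim_eq_card_independent)
  then show ?thesis
    using finite disj B(4) C(4) by (simp add: card_Un_disjoint)
qed

text \<open>Induction on the roots: \<open>U\<close> is the direct sum of the
  \<open>l\<close>-eigenspace \<open>K\<close> and the kernel \<open>V\<close> of the remaining
  product, and the induction hypothesis applies to \<open>V\<close>. Entries of \<open>ls\<close>
  that are not eigenvalues on \<open>U\<close> contribute 0.\<close>

lemma dim_eq_sum_dim_eigenspaces:
  assumes "finite D" and lin: "fun_linear T" and "distinct ls"
    and "fun_vs.subspace U" and "U \<subseteq> matsuo_space D" and "\<And>u. u \<in> U \<Longrightarrow> T u \<in> U"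
    and "\<And>u. u \<in> U \<Longrightarrow> shift_prod T ls u = 0"
  shows "fun_vs.dim U = (\<Sum>l\<in>set ls. fun_vs.dim (eigenspace_on U T l))"
  using assms(3-)
proof (induction ls arbitrary: U)
  case Nil
  then have "U \<subseteq> {0}"
    by (metis shift_prod_simps(1) singletonI subsetI)
  then have "fun_vs.dim U = card ({} :: ('a \<Rightarrow> 'b) set)"
    by (intro fun_vs.dim_unique[of "{}"]) (simp_all add: fun_vs.independent_empty)
  then show ?case by simp
next
  case (Cons l ls)
  define K where "K = eigenspace_on U T l"
  define V where "V = {u \<in> U. shift_prod T ls u = 0}"
  \<comment> \<open>The remaining factors act on \<open>K\<close> as the scalar \<open>c\<close>,
    which is nonzero because \<open>l\<close> is not among the other roots.\<close>
  define c where "c = (\<Prod>k\<leftarrow>ls. l - k)"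
  have c: "c \<noteq> 0"
    using Cons.prems(1) by (auto simp: c_def prod_list_zero_iff)
  have K: "fun_vs.subspace K" "K \<subseteq> U"
    using subspace_eigenspace_on[OF lin Cons.prems(2)] by (auto simp: K_def eigenspace_on_def)
  note lin' = fun_linear_shift_prod[OF lin, of ls]
  have V: "fun_vs.subspace V" "V \<subseteq> U"
    using Cons.prems(2)
    by (auto simp: V_def fun_vs.subspace_def fun_linear_add[OF lin'] fun_linear_scale[OF lin']
        fun_linear_zero[OF lin'])
  have onK: "shift_prod T ls u = fun_scale c u" if "u \<in> K" for u
    using that shift_prod_eigenvector[OF lin, of u l ls] by (auto simp: K_def eigenspace_on_def c_def)
  have "K \<inter> V = {0}"
    using onK c fun_vs.subspace_0[OF K(1)] fun_vs.subspace_0[OF V(1)] by (auto simp: V_def)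
  moreover have "{u + v | u v. u \<in> K \<and> v \<in> V} = U"
  proof (intro subset_antisym subsetI)
    fix u assume u: "u \<in> U"
    define w where "w = shift_prod T ls u"
    have "T w - fun_scale l w = 0"
      using Cons.prems(5)[OF u] by (simp only: w_def shift_prod_simps)
    moreover have "w \<in> U"
      unfolding w_def using Cons.prems(2,4) u by (rule shift_prod_closed)
    ultimately have wK: "w \<in> K"
      by (simp add: K_def eigenspace_on_def)
    \<comment> \<open>This is the component of \<open>u\<close> in \<open>K\<close>: after division
      by \<open>c\<close>, the remaining product sends \<open>w'\<close> and \<open>u\<close> to the
      same vector \<open>w\<close>.\<close>
    define w' where "w' = fun_scale (inverse c) w"
    have w'K: "w' \<in> K"
      using wK K(1) by (simp add: w'_def fun_vs.subspace_scale)
    have "shift_prod T ls (u - w') = w - fun_scale c w'"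
      using onK[OF w'K] by (simp add: fun_linear_diff[OF lin'] w_def)
    also have "\<dots> = 0"
      using c by (simp add: w'_def)
    finally have "u - w' \<in> V"
      using u w'K K(2) Cons.prems(2) by (auto simp: V_def intro!: fun_vs.subspace_diff)
    moreover have "u = w' + (u - w')"
      by simp
    ultimately show "u \<in> {u + v | u v. u \<in> K \<and> v \<in> V}"
      using w'K by fast
  qed (use K V fun_vs.subspace_add[OF Cons.prems(2)] in auto)
  ultimately have dimU: "fun_vs.dim U = fun_vs.dim K + fun_vs.dim V"
    using dim_direct_sum[OF assms(1) K(1) _ V(1)] K(2) V(2) Cons.prems(3) by auto
  have "fun_vs.dim V = (\<Sum>k\<in>set ls. fun_vs.dim (eigenspace_on V T k))"
  proof (rule Cons.IH)
    show "T u \<in> V" if "u \<in> V" for u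
      using that Cons.prems(4) by (simp add: V_def shift_prod_self_commute[OF lin] fun_linear_zero[OF lin])
  qed (use Cons.prems V in \<open>auto simp: V_def\<close>)
  \<comment> \<open>An eigenvector for a root in \<open>ls\<close> is killed by the product over
    \<open>ls\<close>, hence already lies in \<open>V\<close>.\<close>
  moreover have "eigenspace_on V T k = eigenspace_on U T k" if "k \<in> set ls" for k
  proof -
    have "(\<Prod>j\<leftarrow>ls. k - j) = 0"
      using that by (auto simp: prod_list_zero_iff)
    then have "shift_prod T ls u = 0" if "T u = fun_scale k u" for u
      using shift_prod_eigenvector[OF lin that, of ls] by simp
    then show ?thesis
      by (auto simp: eigenspace_on_def V_def)
  qed
  ultimately show ?case
    using dimU Cons.prems(1) by (simp add: K_def)
qed

subsection \<open>Annihilating polynomials and self-adjoint maps\<close>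

definition poly_op :: "(('a \<Rightarrow> 'f::field) \<Rightarrow> 'a \<Rightarrow> 'f) \<Rightarrow> 'f poly \<Rightarrow> ('a \<Rightarrow> 'f) \<Rightarrow> 'a \<Rightarrow> 'f" where
  "poly_op T p u = (\<Sum>i\<le>degree p. fun_scale (coeff p i) ((T ^^ i) u))"

lemma poly_op_altdef:
  assumes "degree p \<le> n"
  shows "poly_op T p u = (\<Sum>i\<le>n. fun_scale (coeff p i) ((T ^^ i) u))"
  unfolding poly_op_def using assms
  by (intro sum.mono_neutral_left) (auto simp: coeff_eq_0)

lemma poly_op_add: "poly_op T (p + q) u = poly_op T p u + poly_op T q u"
proof -
  define n where "n = max (degree p) (degree q)"
  have "degree p \<le> n" "degree q \<le> n" "degree (p + q) \<le> n"
    by (auto simp: n_def degree_add_le)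
  then show ?thesis
    by (simp add: poly_op_altdef[of _ n] fun_vs.scale_left_distrib sum.distrib)
qed

lemma poly_op_smult: "poly_op T (smult c p) u = fun_scale c (poly_op T p u)"
  by (simp add: poly_op_altdef[of _ "degree p"] degree_smult_le fun_vs.scale_sum_right)

lemma poly_op_monom: "poly_op T (monom 1 n) u = (T ^^ n) u"
proof -
  have "poly_op T (monom 1 n) u = (\<Sum>i\<le>n. if i = n then (T ^^ n) u else 0)"
    unfolding poly_op_altdef[OF degree_monom_le] by (intro sum.cong) auto
  then show ?thesis
    by simp
qed

lemma poly_op_pCons_0:
  assumes "fun_linear T"
  shows "poly_op T (pCons 0 p) u = T (poly_op T p u)"
proof -
  have "degree (pCons 0 p) \<le> Suc (degree p)"
    by (rule degree_pCons_le)
  then have "poly_op T (pCons 0 p) u = (\<Sum>i\<le>degree p. fun_scale (coeff p i) (T ((T ^^ i) u)))"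
    by (subst poly_op_altdef[of _ "Suc (degree p)"])
      (simp_all del: sum.atMost_Suc add: sum.atMost_Suc_shift)
  then show ?thesis
    by (simp add: poly_op_def fun_linear_sum[OF assms] fun_linear_scale[OF assms])
qed

lemma poly_op_linear_factor_mult:
  assumes "fun_linear T"
  shows "poly_op T ([:-c, 1:] * p) u = T (poly_op T p u) - fun_scale c (poly_op T p u)"
proof -
  have "[:-c, 1:] * p = pCons 0 p + smult (- c) p"
    by simp
  then show ?thesis
    by (simp only: poly_op_add poly_op_smult poly_op_pCons_0[OF assms] fun_vs.scale_minus_left
        add_uminus_conv_diff)
qed

text \<open>The bridge from polynomials, which factor over an algebraically closed field, to lists
  of roots.\<close>

lemma poly_op_prod_linear_factors:
  assumes "fun_linear T"
  shows "poly_op T (\<Prod>x\<leftarrow>xs. [:-x, 1:]) u = shift_prod T xs u"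
proof (induction xs)
  case Nil
  show ?case
    by (simp add: poly_op_def)
next
  case (Cons x xs)
  then show ?case
    by (simp only: list.map prod_list.Cons poly_op_linear_factor_mult[OF assms] shift_prod_simps)
qed

text \<open>More than \<open>card D\<close> iterates of \<open>u\<close> cannot be independent, so
  some iterate is a combination of the earlier ones; the relation is read as a polynomial.\<close>

lemma ex_annihilating_poly:
  fixes u :: "'a \<Rightarrow> 'f::field"
  assumes "finite D" and lin: "fun_linear T"
    and closed: "\<And>u. u \<in> matsuo_space D \<Longrightarrow> T u \<in> matsuo_space D" and "u \<in> matsuo_space D"
  obtains p where "p \<noteq> 0" and "poly_op T p u = 0"
proof -
  define P where "P n = (\<lambda>i. (T ^^ i) u) ` {..<n}" for n :: nat
  have inM: "(T ^^ i) u \<in> matsuo_space D" for i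
    using assms(4) closed by (induction i) auto
  have "\<exists>n. (T ^^ n) u \<in> fun_vs.span (P n)"
  proof (rule ccontr)
    assume "\<not> ?thesis"
    then have notin: "(T ^^ n) u \<notin> fun_vs.span (P n)" for n
      by simp
    have "fun_vs.independent (P n) \<and> card (P n) = n" for n
    proof (induction n)
      case 0
      show ?case
        by (simp add: P_def fun_vs.independent_empty)
    next
      case (Suc n)
      have P: "P (Suc n) = insert ((T ^^ n) u) (P n)"
        by (simp add: P_def lessThan_Suc)
      have "(T ^^ n) u \<notin> P n"
        using notin[of n] fun_vs.span_base by metis
      moreover have "finite (P n)"
        by (simp add: P_def)
      ultimately show ?case
        unfolding P using Suc fun_vs.independent_insertI[OF notin[of n]] by auto
    qed
    note * = this
    have "P (Suc (card D)) \<subseteq> matsuo_space D"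
      using inM by (auto simp: P_def)
    from finite_independent_matsuo_space(2)[OF assms(1) conjunct1[OF *] this]
    show False
      using * by simp
  qed
  then obtain n where n: "(T ^^ n) u \<in> fun_vs.span (P n)"
    by auto
  \<comment> \<open>The alternative \<open>p = 0\<close> matters for \<open>n = 0\<close>, where no
    degree is below \<open>n\<close> but the span still contains 0.\<close>
  define S where "S = (\<lambda>p. poly_op T p u) ` {p. degree p < n \<or> p = 0}"
  have "fun_vs.subspace S"
  proof (rule fun_vs.subspaceI)
    show "0 \<in> S"
      unfolding S_def by (rule image_eqI[of _ _ 0]) (auto simp: poly_op_def)
    show "v + w \<in> S" if "v \<in> S" "w \<in> S" for v w
    proof -
      from that obtain p q where "v = poly_op T p u" "w = poly_op T q u"
        "degree p < n \<or> p = 0" "degree q < n \<or> q = 0"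
        by (auto simp: S_def)
      then show ?thesis
        unfolding S_def by (intro image_eqI[of _ _ "p + q"]) (auto simp: poly_op_add degree_add_less)
    qed
    show "fun_scale c v \<in> S" if "v \<in> S" for c v
    proof -
      from that obtain p where "v = poly_op T p u" "degree p < n \<or> p = 0"
        by (auto simp: S_def)
      then show ?thesis
        unfolding S_def using degree_smult_le[of c p]
        by (intro image_eqI[of _ _ "smult c p"]) (auto simp: poly_op_smult)
    qed
  qed
  moreover have "P n \<subseteq> S"
  proof
    fix v assume "v \<in> P n"
    then obtain i where "i < n" "v = (T ^^ i) u"
      by (auto simp: P_def)
    then show "v \<in> S"
      unfolding S_def using degree_monom_le[of "1::'f" i]
      by (intro image_eqI[of _ _ "monom 1 i"]) (auto simp: poly_op_monom)
  qed
  ultimately have "fun_vs.span (P n) \<subseteq> S"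
    by (rule fun_vs.span_minimal[rotated])
  with n obtain p where p: "degree p < n \<or> p = 0" "(T ^^ n) u = poly_op T p u"
    by (auto simp: S_def)
  show thesis
  proof (rule that)
    \<comment> \<open>The polynomial \<open>p\<close> has no term of degree \<open>n\<close>, so the
      leading 1 cannot cancel.\<close>
    have "coeff (monom 1 n + smult (-1) p) n = 1"
      using p(1) by (auto simp: coeff_eq_0)
    then show "monom 1 n + smult (-1) p \<noteq> 0"
      by (metis coeff_0 zero_neq_one)
    show "poly_op T (monom 1 n + smult (-1) p) u = 0"
      by (simp only: poly_op_add poly_op_smult poly_op_monom p(2) fun_vs.scale_minus_left
          fun_vs.scale_one add.right_inverse)
  qed
qed

text \<open>Each basis vector has an annihilating polynomial, which splits. Concatenating the root
  lists over the finite set \<open>D\<close> kills all basis vectors at once; repeated roots may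
  occur.\<close>

lemma ex_annihilating_shift_prod:
  fixes T :: "('a \<Rightarrow> 'f::alg_closed_field) \<Rightarrow> 'a \<Rightarrow> 'f"
  assumes fin: "finite D" and lin: "fun_linear T"
    and closed: "\<And>u. u \<in> matsuo_space D \<Longrightarrow> T u \<in> matsuo_space D"
  obtains xs where "\<And>u. u \<in> matsuo_space D \<Longrightarrow> shift_prod T xs u = 0"
proof -
  have ex1: "\<exists>xs. shift_prod T xs u = 0" if u: "u \<in> matsuo_space D" for u
  proof -
    obtain p where p: "p \<noteq> 0" "poly_op T p u = 0"
      using fin lin closed u by (rule ex_annihilating_poly)
    obtain A where A: "p = smult (lead_coeff p) (\<Prod>x\<in>#A. [:-x, 1:])"
      using alg_closed_imp_factorization[OF p(1)] by auto
    obtain xs where xs: "A = mset xs"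
      using ex_mset[of A] by auto
    have "p = smult (lead_coeff p) (\<Prod>x\<leftarrow>xs. [:-x, 1:])"
      using A unfolding xs mset_map[symmetric] prod_mset_prod_list .
    then have "poly_op T p u = fun_scale (lead_coeff p) (shift_prod T xs u)"
      by (metis poly_op_prod_linear_factors[OF lin] poly_op_smult)
    with p have "shift_prod T xs u = 0"
      by (metis fun_vs.scale_eq_0_iff leading_coeff_0_iff)
    then show ?thesis ..
  qed
  have "\<exists>xs. \<forall>x\<in>S. shift_prod T xs (basis_vec x) = 0" if "finite S" "S \<subseteq> D" for S
    using that
  proof (induction S)
    case (insert y S)
    then obtain xs where xs: "\<forall>x\<in>S. shift_prod T xs (basis_vec x) = 0"
      by blast
    obtain ys where ys: "shift_prod T ys (basis_vec y) = 0"
      using ex1[OF basis_vec_in_matsuo_space[of y D]] insert.prems by auto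
    \<comment> \<open>The rightmost list acts first, so the order is chosen according to which list
      kills the given basis vector.\<close>
    have "shift_prod T (xs @ ys) u = shift_prod T (ys @ xs) u" for u
      by (rule shift_prod_perm[OF lin]) simp
    moreover have "shift_prod T (ys @ xs) (basis_vec x) = 0" if "x \<in> S" for x
      unfolding shift_prod_append bspec[OF xs that]
      by (rule fun_linear_zero[OF fun_linear_shift_prod[OF lin]])
    moreover have "shift_prod T (xs @ ys) (basis_vec y) = 0"
      unfolding shift_prod_append ys by (rule fun_linear_zero[OF fun_linear_shift_prod[OF lin]])
    ultimately have "shift_prod T (xs @ ys) (basis_vec x) = 0" if "x \<in> insert y S" for x
      using that by (metis insertE)
    then show ?case
      by blast
  qed auto
  from this[OF fin subset_refl]
  obtain xs where xs: "\<forall>x\<in>D. shift_prod T xs (basis_vec x) = 0" ..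
  have "shift_prod T xs u = 0" if "u \<in> matsuo_space D" for u
    using fin fun_linear_shift_prod[OF lin] _ bspec[OF xs] that
    by (rule fun_linear_eq_on_basis) (auto intro!: fun_linearI simp: fun_scale_def)
  then show thesis
    by (rule that)
qed

section \<open>The Hermitian form and self-adjoint maps\<close>

definition hermitian :: "'a set \<Rightarrow> ('a \<Rightarrow> complex) \<Rightarrow> ('a \<Rightarrow> complex) \<Rightarrow> complex" where
  "hermitian D u v = (\<Sum>x\<in>D. u x * cnj (v x))"

lemma hermitian_diff_left: "hermitian D (u - v) w = hermitian D u w - hermitian D v w"
  by (simp add: hermitian_def left_diff_distrib sum_subtractf)

lemma hermitian_scale_left: "hermitian D (fun_scale c u) v = c * hermitian D u v"
  by (simp add: hermitian_def fun_scale_def sum_distrib_left mult.assoc)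

lemma hermitian_scale_right: "hermitian D u (fun_scale c v) = cnj c * hermitian D u v"
  by (simp add: hermitian_def fun_scale_def sum_distrib_left mult_ac)

lemma hermitian_self_eq_0:
  assumes "finite D" and "u \<in> matsuo_space D" and "hermitian D u u = 0"
  shows "u = 0"
proof
  fix x
  have "hermitian D u u = of_real (\<Sum>x\<in>D. (cmod (u x))\<^sup>2)"
    by (simp add: hermitian_def complex_norm_square[symmetric])
  then have "(\<Sum>x\<in>D. (cmod (u x))\<^sup>2) = 0"
    using assms(3) by (metis of_real_eq_0_iff)
  then have "\<forall>x\<in>D. (cmod (u x))\<^sup>2 = 0"
    using assms(1) by (subst (asm) sum_nonneg_eq_0_iff) auto
  then show "u x = 0 x"
    using assms(2) by (cases "x \<in> D") (auto simp: matsuo_space_def)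
qed

lemma self_adjoint_annihilating:
  fixes T :: "('a \<Rightarrow> complex) \<Rightarrow> 'a \<Rightarrow> complex"
  assumes fin: "finite D" and lin: "fun_linear T"
    and closed: "\<And>u. u \<in> matsuo_space D \<Longrightarrow> T u \<in> matsuo_space D"
    and adj: "\<And>u v. hermitian D (T u) v = hermitian D u (T v)"
  obtains ls where "distinct ls" and "\<forall>u\<in>matsuo_space D. shift_prod T ls u = 0"
    and "\<forall>l\<in>set ls. \<exists>u\<in>matsuo_space D. u \<noteq> 0 \<and> T u = fun_scale l u"
proof -
  \<comment> \<open>In an annihilating list of minimal length every entry is an eigenvalue, and a repeated entry
    would give a generalised eigenvector, which self-adjointness excludes.\<close>
  define ann where "ann xs \<longleftrightarrow> (\<forall>u\<in>matsuo_space D. shift_prod T xs u = 0)" for xs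
  obtain xs0 where "ann xs0"
    using ex_annihilating_shift_prod[OF fin lin closed] unfolding ann_def by metis
  then obtain ls where ls: "ann ls" and min: "\<And>ys. length ys < length ls \<Longrightarrow> \<not> ann ys"
    using arg_min_natI[of ann xs0 length] arg_min_nat_le[of ann _ length] leD by metis
  \<comment> \<open>By minimality, the product without the factor for \<open>l\<close> is nonzero
    somewhere; the omitted factor kills that value, which is thus an eigenvector.\<close>
  have split: "\<exists>u\<in>matsuo_space D. shift_prod T ys u \<noteq> 0 \<and>
      T (shift_prod T ys u) = fun_scale l (shift_prod T ys u)"
    if "mset ls = mset (l # ys)" for l ys
  proof -
    have "length ys < length ls"
      using mset_eq_length[OF that] by simp
    then obtain u where u: "u \<in> matsuo_space D" "shift_prod T ys u \<noteq> 0"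
      using min[of ys] by (auto simp: ann_def)
    have "shift_prod T (l # ys) u = 0"
      using ls u(1) shift_prod_perm[OF lin that, of u] by (auto simp: ann_def)
    with u show ?thesis
      by (intro bexI[of _ u]) auto
  qed
  note sub = subspace_matsuo_space[of D]
  show thesis
  proof (rule that)
    show "\<forall>u\<in>matsuo_space D. shift_prod T ls u = 0"
      using ls by (simp only: ann_def)
    have "\<exists>u\<in>matsuo_space D. u \<noteq> 0 \<and> T u = fun_scale l u" if l: "l \<in> set ls" for l
      using split[of l "remove1 l ls"] l shift_prod_closed[OF sub closed] by force
    then show "\<forall>l\<in>set ls. \<exists>u\<in>matsuo_space D. u \<noteq> 0 \<and> T u = fun_scale l u" ..
    show "distinct ls"
    proof (rule ccontr)
      assume "\<not> distinct ls"
      then obtain as bs cs l where "ls = as @ [l] @ bs @ [l] @ cs"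
        using not_distinct_decomp by blast
      then have "mset ls = mset (l # l # as @ bs @ cs)"
        by simp
      from split[OF this] obtain u where u: "u \<in> matsuo_space D"
        and w: "shift_prod T (l # as @ bs @ cs) u \<noteq> 0"
          "T (shift_prod T (l # as @ bs @ cs) u) = fun_scale l (shift_prod T (l # as @ bs @ cs) u)"
        by metis
      \<comment> \<open>The vector \<open>w\<close> is both in the kernel and in the image of
        \<open>T - l\<close>. Since \<open>l\<close> turns out to be real, \<open>T - l\<close> is
        self-adjoint, and moving it across the form gives
        \<open>hermitian D w w = 0\<close>.\<close>
      define v where "v = shift_prod T (as @ bs @ cs) u"
      define w where "w = shift_prod T (l # as @ bs @ cs) u"
      have w0: "w \<noteq> 0" and Tw: "T w = fun_scale l w" and wv: "w = T v - fun_scale l v"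
        using w by (simp_all only: w_def v_def shift_prod_simps not_False_eq_True)
      have "w \<in> matsuo_space D"
        unfolding w_def by (rule shift_prod_closed[OF sub closed u])
      then have nz: "hermitian D w w \<noteq> 0"
        using hermitian_self_eq_0[OF fin] w0 by metis
      have "l * hermitian D w w = cnj l * hermitian D w w"
        using adj[of w w] by (simp only: Tw hermitian_scale_left hermitian_scale_right)
      with nz have real: "cnj l = l"
        by simp
      have "hermitian D w w = hermitian D (T v) w - l * hermitian D v w"
        by (subst (1) wv) (simp only: hermitian_diff_left hermitian_scale_left)
      also have "\<dots> = 0"
        by (simp only: adj Tw hermitian_scale_right real diff_self)
      finally show False
        using nz by simp
    qed
  qed
qed

lemma fun_trace_diff: "fun_trace D (\<lambda>u. S u - T u) = fun_trace D S - fun_trace D T"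
  by (simp add: fun_trace_def sum_subtractf)

lemma fun_trace_scale: "fun_trace D (\<lambda>u. fun_scale c (T u)) = c * fun_trace D T"
  by (simp add: fun_trace_def fun_scale_def sum_distrib_left)

lemma fun_trace_sum: "fun_trace D (\<lambda>u. \<Sum>i\<in>I. T i u) = (\<Sum>i\<in>I. fun_trace D (T i))"
  unfolding fun_trace_def sum_apply by (rule sum.swap)

subsection \<open>Rationality of the spectrum\<close>

text \<open>The group enters only through the involutions \<open>R i\<close>, which commute with
  \<open>T\<close> and add up to \<open>k + T\<close>. If \<open>P\<close> is the projection to the
  \<open>l\<close>-eigenspace and \<open>n\<close> its rank, then comparing traces writes
  \<open>(k + l) n\<close> as a sum of integers, and \<open>w\<close> shows that \<open>n\<close> is
  nonzero.\<close>

lemma eigenvalue_rational: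
  fixes T :: "('a \<Rightarrow> 'f::field_char_0) \<Rightarrow> 'a \<Rightarrow> 'f"
  assumes fin: "finite D" and lin: "fun_linear T"
    and closed: "\<And>u. u \<in> matsuo_space D \<Longrightarrow> T u \<in> matsuo_space D"
    and R_lin: "\<And>i. i \<in> I \<Longrightarrow> fun_linear (R i)"
    and R_closed: "\<And>i u. i \<in> I \<Longrightarrow> u \<in> matsuo_space D \<Longrightarrow> R i u \<in> matsuo_space D"
    and R_invol: "\<And>i u. i \<in> I \<Longrightarrow> u \<in> matsuo_space D \<Longrightarrow> R i (R i u) = u"
    and R_commute: "\<And>i u. i \<in> I \<Longrightarrow> u \<in> matsuo_space D \<Longrightarrow> R i (T u) = T (R i u)"
    and R_sum: "\<And>u. u \<in> matsuo_space D \<Longrightarrow> (\<Sum>i\<in>I. R i u) = fun_scale (of_nat k) u + T u"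
    and ls: "distinct ls" "\<And>u. u \<in> matsuo_space D \<Longrightarrow> shift_prod T ls u = 0" "l \<in> set ls"
    and w: "w \<in> matsuo_space D" "w \<noteq> 0" "T w = fun_scale l w"
  shows "l \<in> \<rat>"
proof -
  note sub = subspace_matsuo_space[of D]
  define ys where "ys = remove1 l ls"
  have mset: "mset ls = mset (l # ys)" and "l \<notin> set ys"
    using ls(1,3) by (auto simp: ys_def)
  define c where "c = (\<Prod>y\<leftarrow>ys. l - y)"
  have c: "c \<noteq> 0"
    using \<open>l \<notin> set ys\<close> by (auto simp: c_def prod_list_zero_iff)
  \<comment> \<open>Lagrange interpolation: the other factors map into the
    \<open>l\<close>-eigenspace and act on it as \<open>c\<close>, so \<open>P\<close> is the
    projection onto it. As a polynomial in \<open>T\<close>, it commutes with every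
    \<open>R i\<close>.\<close>
  define P where "P u = fun_scale (inverse c) (shift_prod T ys u)" for u
  note S_lin = fun_linear_shift_prod[OF lin, of ys]
  have P_lin: "fun_linear P"
    by (rule fun_linearI) (simp_all only: P_def fun_linear_add[OF S_lin] fun_linear_scale[OF S_lin]
        fun_vs.scale_right_distrib fun_vs.scale_scale mult.commute)
  have P_closed: "P u \<in> matsuo_space D" if "u \<in> matsuo_space D" for u
    unfolding P_def by (intro fun_vs.subspace_scale sub shift_prod_closed[OF sub closed that])
  have TP: "T (P u) = fun_scale l (P u)" if "u \<in> matsuo_space D" for u
  proof -
    have "shift_prod T (l # ys) u = 0"
      using ls(2)[OF that] shift_prod_perm[OF lin mset] by metis
    then have "T (shift_prod T ys u) = fun_scale l (shift_prod T ys u)"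
      by (simp only: shift_prod_simps right_minus_eq)
    then show ?thesis
      by (simp only: P_def fun_linear_scale[OF lin] fun_vs.scale_scale mult.commute)
  qed
  have P_eig: "P v = v" if "T v = fun_scale l v" for v
    using shift_prod_eigenvector[OF lin that, of ys] c by (simp add: P_def c_def[symmetric])
  have PP: "P (P u) = P u" if "u \<in> matsuo_space D" for u
    by (rule P_eig[OF TP[OF that]])
  have RP: "R i (P u) = P (R i u)" if "i \<in> I" "u \<in> matsuo_space D" for i u
    unfolding P_def fun_linear_scale[OF R_lin[OF that(1)]]
    using shift_prod_commute[where S = "R i" and T = T and U = "matsuo_space D",
        OF R_lin[OF that(1)] R_commute[OF that(1)] sub closed that(2)]
    by metis
  obtain n where n: "fun_trace D P = of_nat n"
    and n0: "n = 0 \<longrightarrow> (\<forall>u\<in>matsuo_space D. P u = 0)"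
    using fin P_lin P_closed PP by (rule fun_trace_idempotent)
  have "n \<noteq> 0"
    using n0 w(1,2) P_eig[OF w(3)] by metis
  have trR: "fun_trace D (\<lambda>u. R i (P u)) \<in> \<rat>" if i: "i \<in> I" for i
  proof -
    \<comment> \<open>The involution \<open>R i\<close> on the image of \<open>P\<close> is \<open>P - 2 Q\<close> with \<open>Q\<close> idempotent, so its trace is
      an integer.\<close>
    define Q where "Q u = fun_scale (1 / 2) (P u - R i (P u))" for u
    note Ri = R_lin[OF i]
    have Q_lin: "fun_linear Q"
      by (rule fun_linearI)
        (simp_all only: Q_def fun_linear_add[OF P_lin] fun_linear_scale[OF P_lin]
          fun_linear_add[OF Ri] fun_linear_scale[OF Ri] fun_vs.scale_right_distrib
          fun_vs.scale_right_diff_distrib fun_vs.scale_scale mult.commute add_diff_add)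
    have Q_closed: "Q u \<in> matsuo_space D" if "u \<in> matsuo_space D" for u
      unfolding Q_def using that
      by (intro fun_vs.subspace_scale fun_vs.subspace_diff sub P_closed R_closed i)
    have QQ: "Q (Q u) = Q u" if u: "u \<in> matsuo_space D" for u
    proof -
      \<comment> \<open>The vector \<open>Q u\<close> is fixed by \<open>P\<close> and negated by
        \<open>R i\<close>, and \<open>Q\<close> fixes every such vector.\<close>
      have "P (Q u) = Q u"
        by (simp only: Q_def fun_linear_scale[OF P_lin] fun_linear_diff[OF P_lin] PP u
            RP[OF i P_closed[OF u], symmetric])
      moreover have "R i (Q u) = - Q u"
        by (simp only: Q_def fun_linear_scale[OF Ri] fun_linear_diff[OF Ri]
            R_invol[OF i P_closed[OF u]] fun_vs.scale_minus_right[symmetric] minus_diff_eq)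
      ultimately have "Q (Q u) = fun_scale (1 / 2) (Q u - - Q u)"
        by (subst Q_def) simp
      then show ?thesis
        by (simp add: fun_scale_def fun_eq_iff)
    qed
    obtain q where q: "fun_trace D Q = of_nat q"
      using fin Q_lin Q_closed QQ by (rule fun_trace_idempotent)
    have "(\<lambda>u. R i (P u)) = (\<lambda>u. P u - fun_scale 2 (Q u))"
      by (simp add: Q_def)
    then have "fun_trace D (\<lambda>u. R i (P u)) = of_nat n - 2 * of_nat q"
      by (simp only: fun_trace_diff fun_trace_scale n q)
    then show ?thesis
      by simp
  qed
  have "fun_scale (of_nat k + l) (P u) = (\<Sum>i\<in>I. R i (P u))" if "u \<in> matsuo_space D" for u
    by (simp only: R_sum[OF P_closed[OF that]] TP[OF that] fun_vs.scale_left_distrib)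
  \<comment> \<open>The two maps agree on \<open>matsuo_space D\<close> only, but the trace
    evaluates them just at basis vectors.\<close>
  then have "fun_trace D (\<lambda>u. fun_scale (of_nat k + l) (P u)) = fun_trace D (\<lambda>u. \<Sum>i\<in>I. R i (P u))"
    unfolding fun_trace_def by (intro sum.cong) (simp_all add: basis_vec_in_matsuo_space)
  then have "(of_nat k + l) * of_nat n = (\<Sum>i\<in>I. fun_trace D (\<lambda>u. R i (P u)))"
    by (simp only: fun_trace_scale fun_trace_sum n)
  then have "l = (\<Sum>i\<in>I. fun_trace D (\<lambda>u. R i (P u))) / of_nat n - of_nat k"
    using \<open>n \<noteq> 0\<close> by (simp add: field_simps)
  also have "\<dots> \<in> \<rat>"
    using trR by (intro Rats_diff Rats_divide Rats_sum) auto
  finally show ?thesis .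
qed

section \<open>Adjacency operators of graphs and change of the base field\<close>

definition nbr_sum :: "'a set \<Rightarrow> ('a \<Rightarrow> 'a \<Rightarrow> bool) \<Rightarrow> ('a \<Rightarrow> 'f::field) \<Rightarrow> 'a \<Rightarrow> 'f" where
  "nbr_sum D E u = (\<lambda>x. if x \<in> D then \<Sum>d\<in>D. of_bool (E x d) * u d else 0)"

lemma fun_linear_nbr_sum: "fun_linear (nbr_sum D E)"
  by (rule fun_linearI)
    (auto simp: nbr_sum_def fun_scale_def fun_eq_iff distrib_left sum.distrib sum_distrib_left mult_ac)

lemma nbr_sum_closed: "nbr_sum D E u \<in> matsuo_space D"
  by (auto simp: nbr_sum_def matsuo_space_def)

lemma complex_cnj_of_bool: "cnj (of_bool P) = of_bool P"
  by (cases P) simp_all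

lemma nbr_sum_self_adjoint:
  assumes "\<And>x y. x \<in> D \<Longrightarrow> y \<in> D \<Longrightarrow> E x y \<longleftrightarrow> E y x"
  shows "hermitian D (nbr_sum D E u) v = hermitian D u (nbr_sum D E v)"
proof -
  have "hermitian D (nbr_sum D E u) v = (\<Sum>x\<in>D. \<Sum>d\<in>D. of_bool (E x d) * u d * cnj (v x))"
    by (simp add: hermitian_def nbr_sum_def sum_distrib_right)
  also have "\<dots> = (\<Sum>d\<in>D. \<Sum>x\<in>D. of_bool (E x d) * u d * cnj (v x))"
    by (rule sum.swap)
  also have "\<dots> = (\<Sum>d\<in>D. \<Sum>x\<in>D. u d * (of_bool (E d x) * cnj (v x)))"
    using assms by (intro sum.cong) auto
  also have "\<dots> = hermitian D u (nbr_sum D E v)"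
    by (simp add: hermitian_def nbr_sum_def sum_distrib_left complex_cnj_of_bool)
  finally show ?thesis .
qed

text \<open>The matrix has entries 0 and 1, so it commutes with the embedding of the rationals into
  any field of characteristic 0.\<close>

lemma shift_prod_nbr_sum_of_rat:
  "shift_prod (nbr_sum D E) (map of_rat rs) (\<lambda>x. of_rat (u x)) =
    (\<lambda>x. of_rat (shift_prod (nbr_sum D E) rs u x) :: 'f::field_char_0)"
  by (induction rs)
    (auto simp: fun_eq_iff nbr_sum_def fun_scale_def of_rat_diff of_rat_mult of_rat_sum of_bool_def
      intro!: sum.cong)

text \<open>On basis vectors both sides have rational coordinates. Injectivity of
  \<open>of_rat\<close> brings the identity down from one field to the rationals, and
  \<open>of_rat\<close> carries it up to the other; linearity does the rest.\<close>

lemma shift_prod_nbr_sum_transfer: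
  assumes fin: "finite D"
    and ann: "\<And>u. u \<in> matsuo_space D \<Longrightarrow>
      shift_prod (nbr_sum D E) (map of_rat rs) u = (0 :: 'a \<Rightarrow> 'k::field_char_0)"
    and u: "u \<in> matsuo_space D"
  shows "shift_prod (nbr_sum D E) (map of_rat rs) u = (0 :: 'a \<Rightarrow> 'f::field_char_0)"
proof -
  have basis: "basis_vec x = (\<lambda>y. of_rat (basis_vec x y) :: 'g::field_char_0)" for x :: 'a
    by (simp add: basis_vec_def fun_eq_iff)
  have zero: "shift_prod (nbr_sum D E) rs (basis_vec x) = 0" if "x \<in> D" for x
  proof
    fix y
    have "of_rat (shift_prod (nbr_sum D E) rs (basis_vec x) y) =
        shift_prod (nbr_sum D E) (map of_rat rs) (basis_vec x :: 'a \<Rightarrow> 'k) y"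
      by (subst basis) (simp only: shift_prod_nbr_sum_of_rat)
    also have "\<dots> = 0"
      using ann[OF basis_vec_in_matsuo_space[OF that]] by simp
    finally show "shift_prod (nbr_sum D E) rs (basis_vec x) y = 0 y"
      by simp
  qed
  have "shift_prod (nbr_sum D E) (map of_rat rs) (basis_vec x :: 'a \<Rightarrow> 'f) = 0" if "x \<in> D" for x
    by (subst basis) (simp only: shift_prod_nbr_sum_of_rat zero[OF that], simp add: fun_eq_iff)
  with fin fun_linear_shift_prod[OF fun_linear_nbr_sum] _ show ?thesis
    using u by (rule fun_linear_eq_on_basis) (auto intro!: fun_linearI simp: fun_scale_def)
qed

subsection \<open>The class sum of a 3-transposition group\<close>

text \<open>An injective endomorphism both preserves and reflects the condition that a power is
  trivial. This serves for conjugations and for the flip.\<close>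

lemma (in group) ord_hom_inj:
  assumes "f \<in> hom G G" and "inj_on f (carrier G)" and "x \<in> carrier G"
  shows "ord (f x) = ord x"
proof -
  have f: "f y \<in> carrier G" if "y \<in> carrier G" for y
    using assms(1) that by (auto simp: hom_def)
  interpret group_hom G G f
    using assms(1) by unfold_locales
  have "f x [^] n = \<one> \<longleftrightarrow> x [^] n = \<one>" for n :: nat
  proof -
    have "f x [^] n = f (x [^] n)"
      using assms(3) by (simp add: hom_nat_pow)
    then show ?thesis
      using assms(2,3) by (metis hom_one inj_onD nat_pow_closed one_closed)
  qed
  then show ?thesis
    using assms(3) f by (simp add: ord_unique pow_eq_id)
qed

lemma (in group) inv_cancel_left: "g \<in> carrier G \<Longrightarrow> x \<in> carrier G \<Longrightarrow> inv g \<otimes> (g \<otimes> x) = x"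
  by (simp add: m_assoc[symmetric])

lemma (in group) ord_conjugate:
  assumes "g \<in> carrier G" and "x \<in> carrier G"
  shows "ord (g \<otimes> x \<otimes> inv g) = ord x"
proof (rule ord_hom_inj[of "\<lambda>x. g \<otimes> x \<otimes> inv g"])
  show "(\<lambda>x. g \<otimes> x \<otimes> inv g) \<in> hom G G"
    using assms(1) by (auto simp: hom_def m_assoc inv_cancel_left)
qed (use assms in \<open>auto simp: inj_on_def\<close>)

context three_transposition_group
begin

text \<open>For elements of \<open>D\<close> the product has order 1, 2 or 3, and the orders 1 and 2
  mean equal and distinct commuting elements, which justifies the name.\<close>

definition noncommuting :: "'a \<Rightarrow> 'a \<Rightarrow> bool" where
  "noncommuting x y \<longleftrightarrow> ord (x \<otimes> y) = 3"

text \<open>For \<open>c\<close> in \<open>D\<close>, conjugation by \<open>c\<close> is its own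
  inverse, so this composition is the linear map that sends the basis vector of \<open>d\<close> to
  that of its conjugate.\<close>

definition conj_act :: "'a \<Rightarrow> ('a \<Rightarrow> 'f::field) \<Rightarrow> 'a \<Rightarrow> 'f" where
  "conj_act c u = (\<lambda>x. if x \<in> D then u (c \<otimes> x \<otimes> c) else 0)"

lemma finite_D: "finite D"
  using D_subset finite_carrier by (rule finite_subset)

lemma D_carrier: "d \<in> D \<Longrightarrow> d \<in> carrier G"
  using D_subset by auto

lemma D_square: "d \<in> D \<Longrightarrow> d \<otimes> d = \<one>"
  using pow_ord_eq_1[of d] by (simp add: D_carrier D_involution numeral_2_eq_2)

lemma D_inv: "d \<in> D \<Longrightarrow> inv d = d"
  by (simp add: D_carrier D_square inv_equality)

lemma conj_closed: "c \<in> D \<Longrightarrow> x \<in> D \<Longrightarrow> c \<otimes> x \<otimes> c \<in> D"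
  using D_normal[of c x] by (simp add: D_carrier D_inv)

lemma conj_conj: "c \<in> D \<Longrightarrow> x \<in> carrier G \<Longrightarrow> c \<otimes> (c \<otimes> x \<otimes> c) \<otimes> c = x"
  using D_square[of c] by (simp add: D_carrier m_assoc) (simp add: D_carrier m_assoc[symmetric])

lemma noncommuting_sym:
  assumes "x \<in> D" and "y \<in> D"
  shows "noncommuting x y \<longleftrightarrow> noncommuting y x"
proof -
  have "inv (x \<otimes> y) = y \<otimes> x"
    using assms by (simp add: inv_mult_group D_inv D_carrier)
  then show ?thesis
    unfolding noncommuting_def using assms ord_inv[of "x \<otimes> y"] by (simp add: D_carrier)
qed

lemma noncommuting_conj:
  assumes "g \<in> carrier G" and "x \<in> D" and "y \<in> D"
  shows "noncommuting (g \<otimes> x \<otimes> inv g) (g \<otimes> y \<otimes> inv g) \<longleftrightarrow> noncommuting x y"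
proof -
  have "g \<otimes> x \<otimes> inv g \<otimes> (g \<otimes> y \<otimes> inv g) = g \<otimes> (x \<otimes> y) \<otimes> inv g"
    using assms by (simp add: D_carrier m_assoc inv_cancel_left)
  then show ?thesis
    using assms by (simp add: noncommuting_def ord_conjugate D_carrier)
qed

lemma conj_commuting:
  assumes "c \<in> D" and "x \<in> D" and "\<not> noncommuting x c"
  shows "c \<otimes> x \<otimes> c = x"
proof -
  have car: "c \<in> carrier G" "x \<in> carrier G"
    using assms by (auto simp: D_carrier)
  have "ord (c \<otimes> x) \<noteq> 3"
    using assms noncommuting_sym by (simp add: noncommuting_def)
  \<comment> \<open>The value 0 would stand for infinite order; finiteness of the group excludes
    it.\<close>
  moreover have "1 \<le> ord (c \<otimes> x)"
    using car finite_carrier by (intro ord_ge_1) auto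
  ultimately have "ord (c \<otimes> x) dvd 2"
    using D_ord_le_3[OF assms(1,2)] by (auto simp: le_Suc_eq numeral_3_eq_3 numeral_2_eq_2)
  then have "(c \<otimes> x) [^] (2::nat) = \<one>"
    using car by (simp add: pow_eq_id)
  then have "c \<otimes> x \<otimes> c \<otimes> x = \<one>"
    using car by (simp add: numeral_2_eq_2 m_assoc)
  then have "c \<otimes> x \<otimes> c = inv x"
    using car by (simp add: inv_equality)
  then show ?thesis
    using assms by (simp add: D_inv)
qed

text \<open>This is the braid relation: for involutions, the vanishing of the third power of
  \<open>c \<otimes> x\<close> amounts to it.\<close>

lemma conj_noncommuting:
  assumes "c \<in> D" and "x \<in> D" and "noncommuting x c"
  shows "c \<otimes> x \<otimes> c = x \<otimes> c \<otimes> x"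
proof -
  have car: "c \<in> carrier G" "x \<in> carrier G"
    using assms by (auto simp: D_carrier)
  have "ord (c \<otimes> x) = 3"
    using assms noncommuting_sym by (simp add: noncommuting_def)
  then have "(c \<otimes> x) [^] (3::nat) = \<one>"
    using car by (simp add: pow_eq_id)
  then have "c \<otimes> x \<otimes> c \<otimes> (x \<otimes> c \<otimes> x) = \<one>"
    using car by (simp add: numeral_3_eq_3 m_assoc)
  then have "c \<otimes> x \<otimes> c = inv (x \<otimes> c \<otimes> x)"
    using car by (simp add: inv_equality)
  then show ?thesis
    using assms conj_closed D_inv by simp
qed

text \<open>Elements \<open>c\<close> commuting with \<open>x\<close> contribute \<open>u x\<close>
  each. For the others the braid relation replaces conjugation of \<open>x\<close> by
  \<open>c\<close> with conjugation of \<open>c\<close> by \<open>x\<close>, which permutes the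
  elements not commuting with \<open>x\<close>.\<close>

lemma sum_conj_act:
  assumes "x \<in> D"
  shows "(\<Sum>c\<in>D. conj_act c u) x =
    of_nat (card {c \<in> D. \<not> noncommuting x c}) * u x + nbr_sum D noncommuting u x"
proof -
  let ?N = "{c \<in> D. noncommuting x c}"
  have mem: "x \<otimes> c \<otimes> x \<in> ?N" if "c \<in> ?N" for c
  proof -
    have "noncommuting (x \<otimes> x \<otimes> inv x) (x \<otimes> c \<otimes> inv x)"
      using that assms noncommuting_conj[of x x c] by (simp add: D_carrier)
    then show ?thesis
      using that assms by (simp add: conj_closed D_inv D_square D_carrier)
  qed
  have "(\<Sum>c\<in>D. conj_act c u) x = (\<Sum>c\<in>D. u (c \<otimes> x \<otimes> c))"
    using assms by (simp add: sum_apply conj_act_def)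
  also have "\<dots> = (\<Sum>c\<in>{c \<in> D. \<not> noncommuting x c} \<union> ?N. u (c \<otimes> x \<otimes> c))"
    by (intro sum.cong) auto
  also have "\<dots> = (\<Sum>c\<in>{c \<in> D. \<not> noncommuting x c}. u (c \<otimes> x \<otimes> c)) + (\<Sum>c\<in>?N. u (c \<otimes> x \<otimes> c))"
    using finite_D by (intro sum.union_disjoint) auto
  also have "(\<Sum>c\<in>{c \<in> D. \<not> noncommuting x c}. u (c \<otimes> x \<otimes> c)) =
      of_nat (card {c \<in> D. \<not> noncommuting x c}) * u x"
    using assms by (simp add: conj_commuting)
  also have "(\<Sum>c\<in>?N. u (c \<otimes> x \<otimes> c)) = (\<Sum>c\<in>?N. u (x \<otimes> c \<otimes> x))"
    using assms by (intro sum.cong refl) (metis (lifting) conj_noncommuting mem_Collect_eq)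
  also have "\<dots> = (\<Sum>c\<in>?N. u c)"
    using assms mem D_carrier
    by (intro sum.reindex_bij_witness[of _ "\<lambda>c. x \<otimes> c \<otimes> x" "\<lambda>c. x \<otimes> c \<otimes> x"])
      (auto simp: conj_conj)
  also have "\<dots> = nbr_sum D noncommuting u x"
    unfolding sum.inter_filter[OF finite_D] using assms by (auto simp: nbr_sum_def intro!: sum.cong)
  finally show ?thesis .
qed

lemma fun_linear_conj_act: "fun_linear (conj_act c)"
  by (rule fun_linearI) (auto simp: conj_act_def fun_scale_def fun_eq_iff)

lemma conj_act_closed: "conj_act c u \<in> matsuo_space D"
  by (simp add: conj_act_def matsuo_space_def)

lemma conj_act_involution:
  assumes "c \<in> D" and "u \<in> matsuo_space D"
  shows "conj_act c (conj_act c u) = u"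
  using assms by (auto simp: conj_act_def fun_eq_iff matsuo_space_def conj_closed conj_conj D_carrier)

text \<open>Conjugation by \<open>c\<close> is an automorphism of the noncommuting graph.\<close>

lemma conj_act_nbr_sum:
  assumes "c \<in> D"
  shows "conj_act c (nbr_sum D noncommuting u) = nbr_sum D noncommuting (conj_act c u)"
proof
  fix x
  show "conj_act c (nbr_sum D noncommuting u) x = nbr_sum D noncommuting (conj_act c u) x"
  proof (cases "x \<in> D")
    case True
    have "(\<Sum>d\<in>D. of_bool (noncommuting (c \<otimes> x \<otimes> c) d) * u d) =
        (\<Sum>d\<in>D. of_bool (noncommuting x d) * u (c \<otimes> d \<otimes> c))"
    proof (intro sum.reindex_bij_witness[of _ "\<lambda>d. c \<otimes> d \<otimes> c" "\<lambda>d. c \<otimes> d \<otimes> c"])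
      fix d assume d: "d \<in> D"
      have "noncommuting x (c \<otimes> d \<otimes> c) \<longleftrightarrow> noncommuting (c \<otimes> x \<otimes> c) (c \<otimes> (c \<otimes> d \<otimes> c) \<otimes> c)"
        using noncommuting_conj[of c x "c \<otimes> d \<otimes> c"] True d assms
        by (simp add: D_inv D_carrier conj_closed)
      then show "of_bool (noncommuting x (c \<otimes> d \<otimes> c)) * u (c \<otimes> (c \<otimes> d \<otimes> c) \<otimes> c) =
          of_bool (noncommuting (c \<otimes> x \<otimes> c) d) * u d"
        using assms d by (simp add: conj_conj D_carrier)
    qed (use assms in \<open>auto simp: conj_conj conj_closed D_carrier\<close>)
    then show ?thesis
      using True assms by (simp add: conj_act_def nbr_sum_def conj_closed)
  qed (simp add: conj_act_def nbr_sum_def)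
qed

text \<open>The collinearity map is given by columns, as images of basis vectors;
  \<open>nbr_sum\<close> lists the rows of the same matrix.\<close>

lemma collinearity_map_eq_nbr_sum: "collinearity_map G D = nbr_sum D noncommuting"
proof (intro ext)
  fix u :: "'a \<Rightarrow> 'f::field" and x
  have "collinearity_map G D u x = (\<Sum>d\<in>D. u d * (\<Sum>c\<in>{c \<in> D. noncommuting c d}. basis_vec c x))"
    by (simp add: collinearity_map_def lin_ext_def sum_apply fun_scale_def noncommuting_def)
  moreover have "(\<Sum>c\<in>{c \<in> D. noncommuting c d}. basis_vec c x :: 'f) =
      of_bool (x \<in> D \<and> noncommuting x d)" for d
    using finite_D by (simp add: basis_vec_def of_bool_def)
  ultimately show "collinearity_map G D u x = nbr_sum D noncommuting u x"
    by (simp add: nbr_sum_def mult.commute)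
qed

end

context connected_three_transposition_group
begin

text \<open>Connectedness enters here: an element conjugating \<open>x\<close> to \<open>y\<close>
  carries one set injectively into the other, and the roles of \<open>x\<close> and \<open>y\<close>
  can be exchanged.\<close>

lemma card_commuting_eq:
  assumes "x \<in> D" and "y \<in> D"
  shows "card {c \<in> D. \<not> noncommuting x c} = card {c \<in> D. \<not> noncommuting y c}"
proof -
  have le: "card {c \<in> D. \<not> noncommuting x c} \<le> card {c \<in> D. \<not> noncommuting y c}"
    if xy: "x \<in> D" "y \<in> D" for x y
  proof -
    obtain d a b where d: "d \<in> carrier G" "a \<in> carrier G" "b \<in> carrier G"
      and x: "x = a \<otimes> d \<otimes> inv a" and y: "y = b \<otimes> d \<otimes> inv b"
      using D_conjugacy_class xy by auto
    define g where "g = b \<otimes> inv a"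
    have g: "g \<in> carrier G"
      using d by (simp add: g_def)
    have "g \<otimes> x \<otimes> inv g = y"
      using d by (simp add: g_def x y inv_mult_group m_assoc inv_cancel_left)
    then have "(\<lambda>c. g \<otimes> c \<otimes> inv g) ` {c \<in> D. \<not> noncommuting x c} \<subseteq> {c \<in> D. \<not> noncommuting y c}"
      using noncommuting_conj[OF g xy(1)] D_normal[OF g] by auto
    moreover have "inj_on (\<lambda>c. g \<otimes> c \<otimes> inv g) {c \<in> D. \<not> noncommuting x c}"
      using g by (auto simp: inj_on_def D_carrier)
    ultimately show ?thesis
      using finite_D by (intro card_inj_on_le) auto
  qed
  show ?thesis
    using le[OF assms] le[OF assms(2,1)] by simp
qed

lemma ex_rational_annihilating:
  obtains rs where "distinct rs"
    and "\<forall>u\<in>matsuo_space D.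
      shift_prod (collinearity_map G D) (map of_rat rs) u = (0 :: 'a \<Rightarrow> 'f::field_char_0)"
proof -
  \<comment> \<open>The complex numbers provide both the roots of polynomials and a positive
    definite form; only the final transfer reaches the field \<open>'f\<close>.\<close>
  let ?T = "nbr_sum D noncommuting :: ('a \<Rightarrow> complex) \<Rightarrow> 'a \<Rightarrow> complex"
  obtain ls where ls: "distinct ls" "\<forall>u\<in>matsuo_space D. shift_prod ?T ls u = 0"
    "\<forall>l\<in>set ls. \<exists>u\<in>matsuo_space D. u \<noteq> 0 \<and> ?T u = fun_scale l u"
    using finite_D fun_linear_nbr_sum nbr_sum_closed nbr_sum_self_adjoint[of D noncommuting, OF noncommuting_sym]
    by (rule self_adjoint_annihilating)
  obtain k where k: "\<And>x. x \<in> D \<Longrightarrow> card {c \<in> D. \<not> noncommuting x c} = k"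
    using card_commuting_eq by metis
  have sum: "(\<Sum>c\<in>D. conj_act c u) = fun_scale (of_nat k) u + ?T u" if "u \<in> matsuo_space D" for u
  proof
    fix x
    show "(\<Sum>c\<in>D. conj_act c u) x = (fun_scale (of_nat k) u + ?T u) x"
    proof (cases "x \<in> D")
      case True
      then show ?thesis
        using sum_conj_act[OF True, of u] k by (simp add: fun_scale_def)
    next
      case False
      then show ?thesis
        using that by (simp add: sum_apply conj_act_def nbr_sum_def matsuo_space_def fun_scale_def)
    qed
  qed
  have "l \<in> \<rat>" if l: "l \<in> set ls" for l
  proof -
    obtain w where w: "w \<in> matsuo_space D" "w \<noteq> 0" "?T w = fun_scale l w"
      using bspec[OF ls(3) l] by metis
    show ?thesis
      by (rule eigenvalue_rational[where T = ?T and R = conj_act and I = D and k = k and ls = ls,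
            OF finite_D fun_linear_nbr_sum nbr_sum_closed fun_linear_conj_act conj_act_closed
              conj_act_involution conj_act_nbr_sum sum ls(1) bspec[OF ls(2)] l w])
  qed
  then have "\<exists>rs. ls = map of_rat rs"
    unfolding ex_map_conv by (auto elim: Rats_cases)
  then obtain rs where rs: "ls = map of_rat rs" ..
  show thesis
  proof (rule that)
    show "distinct rs"
      using ls(1) by (simp add: rs distinct_map)
    have "shift_prod (collinearity_map G D) (map of_rat rs) u = (0 :: 'a \<Rightarrow> 'f)"
      if "u \<in> matsuo_space D" for u
      unfolding collinearity_map_eq_nbr_sum using finite_D bspec[OF ls(2)[unfolded rs]] that
      by (rule shift_prod_nbr_sum_transfer)
    then show "\<forall>u\<in>matsuo_space D.
        shift_prod (collinearity_map G D) (map of_rat rs) u = (0 :: 'a \<Rightarrow> 'f)" ..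
  qed
qed

end

section \<open>The action of the flip\<close>

context three_transposition_group
begin

lemma flip_act_eq_0: "\<sigma> ` D = D \<Longrightarrow> x \<notin> D \<Longrightarrow> flip_act D \<sigma> u x = 0"
  by (auto simp: flip_act_def lin_ext_def sum_apply fun_scale_def basis_vec_def intro!: sum.neutral)

lemma flip_act_apply:
  assumes "inj_on \<sigma> D" and "y \<in> D"
  shows "flip_act D \<sigma> u (\<sigma> y) = u y"
proof -
  have "flip_act D \<sigma> u (\<sigma> y) = (\<Sum>d\<in>D. if y = d then u d else 0)"
    unfolding flip_act_def lin_ext_def sum_apply
    using assms by (intro sum.cong) (auto simp: fun_scale_def basis_vec_def dest: inj_onD)
  also have "\<dots> = u y"
    using assms(2) finite_D by simp
  finally show ?thesis .
qed

lemma fun_linear_flip_act: "fun_linear (flip_act D \<sigma>)"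
  by (rule fun_linearI)
    (simp_all add: flip_act_def lin_ext_def fun_vs.scale_left_distrib sum.distrib
      fun_vs.scale_sum_right, simp_all add: fun_scale_def mult_ac)

text \<open>As an injective endomorphism \<open>\<sigma>\<close> preserves orders of products, so it
  permutes \<open>D\<close> as an automorphism of the noncommuting graph.\<close>

lemma flip_act_collinearity_map:
  assumes "\<sigma> \<in> hom G G" and "inj_on \<sigma> (carrier G)" and im: "\<sigma> ` D = D"
  shows "flip_act D \<sigma> (collinearity_map G D u) = collinearity_map G D (flip_act D \<sigma> u)"
  unfolding collinearity_map_eq_nbr_sum
proof
  fix x
  have inj: "inj_on \<sigma> D"
    using assms(2) D_subset by (rule inj_on_subset)
  have nc: "noncommuting (\<sigma> y) (\<sigma> d) \<longleftrightarrow> noncommuting y d" if "y \<in> D" "d \<in> D" for y d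
    using that ord_hom_inj[OF assms(1,2), of "y \<otimes> d"] assms(1)
    by (simp add: noncommuting_def D_carrier hom_def)
  show "flip_act D \<sigma> (nbr_sum D noncommuting u) x = nbr_sum D noncommuting (flip_act D \<sigma> u) x"
  proof (cases "x \<in> D")
    case True
    then obtain y where y: "y \<in> D" "x = \<sigma> y"
      using im by auto
    have "(\<Sum>d\<in>D. of_bool (noncommuting (\<sigma> y) d) * flip_act D \<sigma> u d) =
        (\<Sum>d\<in>\<sigma> ` D. of_bool (noncommuting (\<sigma> y) d) * flip_act D \<sigma> u d)"
      by (simp only: im)
    also have "\<dots> = (\<Sum>d\<in>D. of_bool (noncommuting y d) * u d)"
      using inj y by (simp add: sum.reindex nc flip_act_apply)
    finally show ?thesis
      using True y inj by (simp add: flip_act_apply nbr_sum_def)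
  next
    case False
    then show ?thesis
      using im by (simp add: flip_act_eq_0 nbr_sum_def)
  qed
qed

end

theorem proposition8p3:
  fixes G :: "('a, 'b) monoid_scheme" and D :: "'a set"
    and \<sigma> :: "'a \<Rightarrow> 'a" and \<eta> :: "'f::field_char_0"
    and M W :: "('a \<Rightarrow> 'f) set" and t :: "('a \<Rightarrow> 'f) \<Rightarrow> 'a \<Rightarrow> 'f"
    and \<Lambda> :: "'f set" and m :: "'f \<Rightarrow> nat"
  assumes "\<eta> \<noteq> 0" "\<eta> \<noteq> 1"
    and "connected_three_transposition_group G D"
    and "is_flip G D \<sigma>"
  defines "M \<equiv> matsuo_space D"
    and "W \<equiv> flip_commutator D \<sigma>"
    and "t \<equiv> collinearity_map G D"
    and "\<Lambda> \<equiv> eigenvalues_on M t"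
    and "m \<equiv> \<lambda>l. fun_vs.dim (eigenspace_on W t l)"
  shows "(\<Sum>l\<in>\<Lambda>. m l) = fun_vs.dim W"
proof -
  interpret connected_three_transposition_group G D
    by fact
  have \<sigma>: "\<sigma> \<in> hom G G" "inj_on \<sigma> (carrier G)" "\<sigma> ` D = D"
    using assms(4) by (auto simp: is_flip_def auto_def Bij_def bij_betw_def)
  obtain rs where rs: "distinct rs"
    and "\<forall>u\<in>M. shift_prod t (map of_rat rs) u = 0"
    unfolding M_def t_def by (rule ex_rational_annihilating)
  then have ann: "shift_prod t (map of_rat rs) u = 0" if "u \<in> M" for u
    using that by metis
  define ls :: "'f list" where "ls = map of_rat rs"
  have "distinct ls"
    using rs by (simp add: ls_def distinct_map inj_on_def)
  have t_lin: "fun_linear t"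
    unfolding t_def collinearity_map_eq_nbr_sum by (rule fun_linear_nbr_sum)
  have F_lin: "fun_linear (flip_act D \<sigma> :: ('a \<Rightarrow> 'f) \<Rightarrow> 'a \<Rightarrow> 'f)"
    by (rule fun_linear_flip_act)
  have W_lin: "fun_linear (\<lambda>u :: 'a \<Rightarrow> 'f. u - flip_act D \<sigma> u)"
    by (rule fun_linearI) (simp_all only: fun_linear_add[OF F_lin] fun_linear_scale[OF F_lin]
        fun_vs.scale_right_diff_distrib add_diff_add)
  \<comment> \<open>As the image of \<open>M\<close> under a linear map that commutes with
    \<open>t\<close>, the set \<open>W\<close> is a \<open>t\<close>-invariant subspace.\<close>
  have W_image: "W = (\<lambda>u. u - flip_act D \<sigma> u) ` M"
    by (auto simp: W_def M_def flip_commutator_def)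
  have W_sub: "fun_vs.subspace W"
    unfolding W_image M_def using W_lin subspace_matsuo_space by (rule module_hom.subspace_image)
  have W_M: "W \<subseteq> M"
    using \<sigma>(3) by (auto simp: W_image M_def matsuo_space_def flip_act_eq_0)
  have W_t: "t u \<in> W" if u: "u \<in> W" for u
  proof -
    obtain v where v: "u = v - flip_act D \<sigma> v"
      using u unfolding W_image by (rule imageE)
    have "t u = t v - flip_act D \<sigma> (t v)"
      unfolding v fun_linear_diff[OF t_lin] unfolding t_def
      by (simp only: flip_act_collinearity_map[OF \<sigma>])
    moreover have "t v \<in> M"
      unfolding t_def M_def collinearity_map_eq_nbr_sum by (rule nbr_sum_closed)
    ultimately show ?thesis
      unfolding W_image by (rule image_eqI)
  qed
  \<comment> \<open>The product that vanishes on \<open>M\<close> also vanishes on \<open>W\<close>.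
    It remains to pass from the entries of \<open>ls\<close> to \<open>\<Lambda>\<close>.\<close>
  have dimW: "fun_vs.dim W = (\<Sum>l\<in>set ls. m l)"
    unfolding m_def using finite_D t_lin \<open>distinct ls\<close> W_sub W_M[unfolded M_def] W_t
    by (rule dim_eq_sum_dim_eigenspaces) (use ann W_M in \<open>auto simp: ls_def\<close>)
  have "\<Lambda> \<subseteq> set ls"
  proof
    fix l assume "l \<in> \<Lambda>"
    then obtain u where u: "u \<in> M" "u \<noteq> 0" "t u = fun_scale l u"
      by (auto simp: \<Lambda>_def eigenvalues_on_def eigenspace_on_def)
    \<comment> \<open>On an eigenvector the vanishing product is a scalar, so one of its factors
      \<open>l - k\<close> is 0.\<close>
    have "fun_scale (\<Prod>k\<leftarrow>ls. l - k) u = 0"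
      using shift_prod_eigenvector[OF t_lin u(3), of ls] ann[OF u(1)] unfolding ls_def by metis
    then have "(\<Prod>k\<leftarrow>ls. l - k) = 0"
      using u(2) by (simp only: fun_vs.scale_eq_0_iff simp_thms)
    then show "l \<in> set ls"
      by (auto simp: prod_list_zero_iff)
  qed
  \<comment> \<open>An eigenvector in \<open>W\<close> is one in \<open>M\<close>, so entries of
    \<open>ls\<close> outside \<open>\<Lambda>\<close> add nothing.\<close>
  moreover have "m l = 0" if "l \<notin> \<Lambda>" for l
  proof -
    have "u = 0" if "u \<in> eigenspace_on W t l" for u
      using that \<open>l \<notin> \<Lambda>\<close> W_M unfolding \<Lambda>_def eigenvalues_on_def eigenspace_on_def by fast
    then have "eigenspace_on W t l \<subseteq> fun_vs.span {}"
      by auto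
    then have "m l \<le> card ({} :: ('a \<Rightarrow> 'f) set)"
      unfolding m_def by (rule fun_vs.dim_le_card) simp
    then show ?thesis
      by simp
  qed
  ultimately show ?thesis
    unfolding dimW by (intro sum.mono_neutral_left) auto
qed

end
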